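(* Let $F\colon M\to N$ be a smooth map of manifolds. (i) (Target edge, $M=\varnothing$.) If $M=\varnothing$ then $\Omega^k(F)=\Omega^k(N)$ with $d_F=d$, $C_k(F)=C_k(N)$ with $\partial_F=\partial$, and the pairing is $\langle(\alpha,0),(S,0)\rangle=\int_S\alpha$. Hence $H^\bullet(\Omega(F))\cong H^\bullet_{\mathrm{dR}}(N)$ and $H_\bullet(F)\cong H_\bullet(N;\mathbb Z)$, compatibly with the pairing. (ii) (Source edge, $N=\mathrm{pt}$.) If $N=\mathrm{pt}$ then the relative complex is $$\Omega^0(F)=\mathbb R\xrightarrow{\;c\mapsto(0,c)\;}\Omega^1(F)=C^\infty(M)\xrightarrow{\;-d\;}\Omega^2(F)=\Omega^1(M)\xrightarrow{\;-d\;}\cdots,$$ that is, $\Omega^k(F)=\Omega^{k-1}(M)$ for $k\ge1$ with differential $-d$, augmented by the constants in degree $0$. Consequently $H^0(\Omega(F))=0$ when $M\ne\varnothing$, and $H^k(\Omega(F))\cong\widetilde H^{k-1}_{\mathrm{dR}}(M)$ for $k\ge1$ (reduced cohomology), and the pairing is $\langle(0,\beta),(S,T)\rangle=-\int_T\beta$: the relative pairing is the negative of the absolute one.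
   Context: $\Omega^k(F)=\Omega^k(N)\oplus\Omega^{k-1}(M)$ with $d_F(\alpha,\beta)=(d\alpha,F^*\alpha-d\beta)$. $C_k(F)=C_k(N)\oplus C_{k-1}(M)$ (smooth singular integral chains) with $\partial_F(S,T)=(\partial S-F_*T,-\partial T)$; $H_k(F)$ is its homology. Pairing: $\langle(\alpha,\beta),(S,T)\rangle=\int_S\alpha-\int_T\beta$. *)

theory Defs
  imports
    "HOL-Analysis.Analysis"
    "HOL-Homology.Homology"
    "HOL-Algebra.Module"
    "HOL-Library.Function_Algebras"
    "HOL-Library.Set_Algebras"
begin

text \<open>Differential forms are functions with real values; the pointwise vector space structure on
  function types is used both for forms and for vectors in coordinate space.\<close>

instantiation "fun" :: (type, scaleR) scaleR
begin

definition scaleR_fun_def: "r *\<^sub>R f = (\<lambda>x. r *\<^sub>R f x)"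

instance ..

end

instance "fun" :: (type, real_vector) real_vector
  by standard (simp_all add: scaleR_fun_def fun_eq_iff scaleR_add_right scaleR_add_left)


section \<open>Smooth functions on coordinate space\<close>

text \<open>Coordinate \<open>n\<close>-space is the carrier of \<^term>\<open>Euclidean_space n\<close>, i.e. the sequences
  vanishing from index \<open>n\<close> on; unlike \<open>real^'n\<close> this includes dimension \<open>0\<close>.\<close>

abbreviation coord_space :: "nat \<Rightarrow> (nat \<Rightarrow> real) set" where
  "coord_space n \<equiv> topspace (Euclidean_space n)"

definition unit_vec :: "nat \<Rightarrow> nat \<Rightarrow> real" where
  "unit_vec i = (\<lambda>j. if j = i then 1 else 0)"

definition dir_deriv :: "((nat \<Rightarrow> real) \<Rightarrow> real) \<Rightarrow> (nat \<Rightarrow> real) \<Rightarrow> (nat \<Rightarrow> real) \<Rightarrow> real" where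
  "dir_deriv f x v = deriv (\<lambda>t. f (x + t *\<^sub>R v)) 0"

fun iter_partial :: "nat list \<Rightarrow> ((nat \<Rightarrow> real) \<Rightarrow> real) \<Rightarrow> (nat \<Rightarrow> real) \<Rightarrow> real" where
  "iter_partial [] f = f"
| "iter_partial (i # is) f = (\<lambda>x. dir_deriv (iter_partial is f) x (unit_vec i))"

text \<open>\<open>V\<close> is meant to be open in \<^term>\<open>Euclidean_space n\<close>: all iterated partial derivatives exist
  and are continuous on \<open>V\<close>.\<close>

definition C_infinity_on :: "nat \<Rightarrow> (nat \<Rightarrow> real) set \<Rightarrow> ((nat \<Rightarrow> real) \<Rightarrow> real) \<Rightarrow> bool" where
  "C_infinity_on n V f \<longleftrightarrow>
     (\<forall>is. set is \<subseteq> {..<n} \<longrightarrow>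
        continuous_map (subtopology (Euclidean_space n) V) euclideanreal (iter_partial is f) \<and>
        (\<forall>i<n. \<forall>x\<in>V. (\<lambda>t. iter_partial is f (x + t *\<^sub>R unit_vec i)) differentiable (at 0)))"


section \<open>Smooth manifolds and smooth maps\<close>

type_synonym 'a chart = "'a set \<times> ('a \<Rightarrow> nat \<Rightarrow> real)"

record 'a manifold =
  mtop :: "'a topology"
  mdim :: nat
  matlas :: "'a chart set"

definition chart_image :: "'a chart \<Rightarrow> (nat \<Rightarrow> real) set" where
  "chart_image c = snd c ` fst c"

definition chart_inv :: "'a chart \<Rightarrow> (nat \<Rightarrow> real) \<Rightarrow> 'a" where
  "chart_inv c = inv_into (fst c) (snd c)"

definition smooth_manifold :: "'a manifold \<Rightarrow> bool" where
  "smooth_manifold M \<longleftrightarrow>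
     Hausdorff_space (mtop M) \<and> second_countable (mtop M) \<and>
     (\<Union>c\<in>matlas M. fst c) = topspace (mtop M) \<and>
     (\<forall>c\<in>matlas M.
        openin (mtop M) (fst c) \<and>
        openin (Euclidean_space (mdim M)) (chart_image c) \<and>
        homeomorphic_map (subtopology (mtop M) (fst c))
          (subtopology (Euclidean_space (mdim M)) (chart_image c)) (snd c)) \<and>
     (\<forall>c\<in>matlas M. \<forall>c'\<in>matlas M. \<forall>j<mdim M.
        C_infinity_on (mdim M) (snd c ` (fst c \<inter> fst c')) (\<lambda>x. snd c' (chart_inv c x) j))"

definition chart_at :: "'a manifold \<Rightarrow> 'a \<Rightarrow> 'a chart" where
  "chart_at M p = (SOME c. c \<in> matlas M \<and> p \<in> fst c)"

text \<open>\<open>W\<close> is meant to be open in \<^term>\<open>Euclidean_space m\<close>.\<close>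

definition smooth_from_coords ::
    "nat \<Rightarrow> (nat \<Rightarrow> real) set \<Rightarrow> 'a manifold \<Rightarrow> ((nat \<Rightarrow> real) \<Rightarrow> 'a) \<Rightarrow> bool" where
  "smooth_from_coords m W N g \<longleftrightarrow>
     continuous_map (subtopology (Euclidean_space m) W) (mtop N) g \<and>
     (\<forall>c\<in>matlas N. \<forall>j<mdim N.
        C_infinity_on m {x \<in> W. g x \<in> fst c} (\<lambda>x. snd c (g x) j))"

definition smooth_map :: "'a manifold \<Rightarrow> 'b manifold \<Rightarrow> ('a \<Rightarrow> 'b) \<Rightarrow> bool" where
  "smooth_map M N F \<longleftrightarrow>
     (\<forall>c\<in>matlas M. smooth_from_coords (mdim M) (chart_image c) N (F \<circ> chart_inv c))"

definition smooth_functions :: "'a manifold \<Rightarrow> ('a \<Rightarrow> real) set" where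
  "smooth_functions M = {f \<in> extensional (topspace (mtop M)).
     \<forall>c\<in>matlas M. C_infinity_on (mdim M) (chart_image c) (f \<circ> chart_inv c)}"


section \<open>Differential forms\<close>

text \<open>A \<open>k\<close>-form is a family of \<open>k\<close>-forms on the chart images, one for each chart of the atlas,
  compatible under the transition maps. A form on an open subset of coordinate \<open>n\<close>-space sends
  a point and a list of \<open>k\<close> vectors to a real number. Outside the meaningful arguments the value
  is \<open>0\<close>, so that equality of forms is equality of functions.\<close>

type_synonym 'a form = "'a chart \<Rightarrow> (nat \<Rightarrow> real) \<Rightarrow> (nat \<Rightarrow> real) list \<Rightarrow> real"

definition vec_tuples :: "nat \<Rightarrow> nat \<Rightarrow> (nat \<Rightarrow> real) list set" where
  "vec_tuples n k = {vs. length vs = k \<and> set vs \<subseteq> coord_space n}"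

definition alternating_multilinear :: "nat \<Rightarrow> nat \<Rightarrow> ((nat \<Rightarrow> real) list \<Rightarrow> real) \<Rightarrow> bool" where
  "alternating_multilinear n k A \<longleftrightarrow>
     (\<forall>vs\<in>vec_tuples n k. \<forall>i<k. \<forall>u\<in>coord_space n. \<forall>w\<in>coord_space n. \<forall>a b.
        A (vs[i := a *\<^sub>R u + b *\<^sub>R w]) = a * A (vs[i := u]) + b * A (vs[i := w])) \<and>
     (\<forall>vs\<in>vec_tuples n k. \<forall>i<k. \<forall>j<k. i \<noteq> j \<and> vs ! i = vs ! j \<longrightarrow> A vs = 0)"

definition push_vec ::
    "((nat \<Rightarrow> real) \<Rightarrow> nat \<Rightarrow> real) \<Rightarrow> (nat \<Rightarrow> real) \<Rightarrow> (nat \<Rightarrow> real) \<Rightarrow> nat \<Rightarrow> real" where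
  "push_vec g x v = (\<lambda>j. dir_deriv (\<lambda>y. g y j) x v)"

definition diff_forms :: "'a manifold \<Rightarrow> nat \<Rightarrow> 'a form set" where
  "diff_forms M k = {\<omega>.
     (\<forall>c x vs. \<not> (c \<in> matlas M \<and> x \<in> chart_image c \<and> vs \<in> vec_tuples (mdim M) k) \<longrightarrow>
        \<omega> c x vs = 0) \<and>
     (\<forall>c\<in>matlas M. \<forall>x\<in>chart_image c. alternating_multilinear (mdim M) k (\<omega> c x)) \<and>
     (\<forall>c\<in>matlas M. \<forall>vs\<in>vec_tuples (mdim M) k.
        C_infinity_on (mdim M) (chart_image c) (\<lambda>x. \<omega> c x vs)) \<and>
     (\<forall>c\<in>matlas M. \<forall>c'\<in>matlas M. \<forall>x\<in>snd c ` (fst c \<inter> fst c'). \<forall>vs\<in>vec_tuples (mdim M) k.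
        \<omega> c x vs = \<omega> c' (snd c' (chart_inv c x)) (map (push_vec (snd c' \<circ> chart_inv c) x) vs))}"

definition function_form :: "'a manifold \<Rightarrow> ('a \<Rightarrow> real) \<Rightarrow> 'a form" where
  "function_form M f = (\<lambda>c x vs.
     if c \<in> matlas M \<and> x \<in> chart_image c \<and> vs = [] then f (chart_inv c x) else 0)"

definition const_form :: "'a manifold \<Rightarrow> real \<Rightarrow> 'a form" where
  "const_form M r = function_form M (\<lambda>_. r)"

text \<open>For vectors held constant in the chart: \<open>(d\<omega>)(v\<^sub>0,\<dots>,v\<^sub>k)\<close> is the alternating sum over \<open>i\<close>
  of the derivative in direction \<open>v\<^sub>i\<close> of \<open>\<omega>(v\<^sub>0,\<dots>,v\<^sub>k)\<close> with \<open>v\<^sub>i\<close> omitted, without a factor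
  \<open>1/(k+1)\<close>.\<close>

definition ext_deriv :: "'a manifold \<Rightarrow> 'a form \<Rightarrow> 'a form" where
  "ext_deriv M \<omega> = (\<lambda>c x vs.
     if c \<in> matlas M \<and> x \<in> chart_image c \<and> set vs \<subseteq> coord_space (mdim M)
     then \<Sum>i<length vs. (-1) ^ i *
            dir_deriv (\<lambda>y. \<omega> c y (take i vs @ drop (Suc i) vs)) x (vs ! i)
     else 0)"

text \<open>The value at \<open>x\<close> of the pullback of \<open>\<omega>\<close> along a smooth map \<open>g\<close> from an open subset of a
  coordinate space to \<open>N\<close>; by compatibility the choice of chart around \<open>g x\<close> is irrelevant.\<close>

definition pullback_at ::
    "'a manifold \<Rightarrow> ((nat \<Rightarrow> real) \<Rightarrow> 'a) \<Rightarrow> 'a form \<Rightarrow> (nat \<Rightarrow> real) \<Rightarrow> (nat \<Rightarrow> real) list \<Rightarrow> real" where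
  "pullback_at N g \<omega> x vs =
     (let c = chart_at N (g x) in \<omega> c (snd c (g x)) (map (push_vec (snd c \<circ> g) x) vs))"

definition pullback :: "'a manifold \<Rightarrow> 'b manifold \<Rightarrow> ('a \<Rightarrow> 'b) \<Rightarrow> 'b form \<Rightarrow> 'a form" where
  "pullback M N F \<omega> = (\<lambda>c x vs.
     if c \<in> matlas M \<and> x \<in> chart_image c \<and> set vs \<subseteq> coord_space (mdim M)
     then pullback_at N (F \<circ> chart_inv c) \<omega> x vs else 0)"


section \<open>Smooth singular chains and integration\<close>

text \<open>The standard \<open>k\<close>-simplex of the homology library lies in coordinate \<open>(k+1)\<close>-space; a singular
  simplex is smooth if it extends smoothly to an open neighbourhood of each point.\<close>

definition smooth_simplex :: "nat \<Rightarrow> 'a manifold \<Rightarrow> ((nat \<Rightarrow> real) \<Rightarrow> 'a) \<Rightarrow> bool" where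
  "smooth_simplex k N \<sigma> \<longleftrightarrow>
     singular_simplex k (mtop N) \<sigma> \<and>
     (\<forall>x\<in>standard_simplex k. \<exists>W g. openin (Euclidean_space (Suc k)) W \<and> x \<in> W \<and>
        smooth_from_coords (Suc k) W N g \<and> (\<forall>y\<in>W \<inter> standard_simplex k. g y = \<sigma> y))"

definition smooth_chains :: "'a manifold \<Rightarrow> nat \<Rightarrow> 'a chain set" where
  "smooth_chains N k = {S. Poly_Mapping.keys S \<subseteq> Collect (smooth_simplex k N)}"

text \<open>The standard simplex is parametrized by \<open>(t\<^sub>1,\<dots>,t\<^sub>k) \<mapsto> (1 - t\<^sub>1 - \<dots> - t\<^sub>k, t\<^sub>1, \<dots>, t\<^sub>k)\<close>,
  with the orientation of \<open>dt\<^sub>1 \<dots> dt\<^sub>k\<close>; its boundary, a null set, is left out of the integral.\<close>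

definition simplex_param :: "nat \<Rightarrow> (nat \<Rightarrow> real) \<Rightarrow> nat \<Rightarrow> real" where
  "simplex_param k t = (\<lambda>i. if i = 0 then 1 - (\<Sum>j=1..k. t j) else if i \<le> k then t i else 0)"

definition open_simplex :: "nat \<Rightarrow> (nat \<Rightarrow> real) set" where
  "open_simplex k = {t \<in> extensional {1..k}. (\<forall>i\<in>{1..k}. 0 < t i) \<and> (\<Sum>i=1..k. t i) < 1}"

definition simplex_integral ::
    "'a manifold \<Rightarrow> nat \<Rightarrow> ((nat \<Rightarrow> real) \<Rightarrow> 'a) \<Rightarrow> 'a form \<Rightarrow> real" where
  "simplex_integral N k \<sigma> \<omega> =
     (LINT t : open_simplex k | (\<Pi>\<^sub>M i\<in>{1..k}. lborel).
        pullback_at N (\<sigma> \<circ> simplex_param k) \<omega> t (map unit_vec [1..<Suc k]))"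

definition chain_integral :: "'a manifold \<Rightarrow> nat \<Rightarrow> 'a chain \<Rightarrow> 'a form \<Rightarrow> real" where
  "chain_integral N k S \<omega> =
     (\<Sum>\<sigma>\<in>Poly_Mapping.keys S. of_int (Poly_Mapping.lookup S \<sigma>) * simplex_integral N k \<sigma> \<omega>)"


section \<open>The relative complexes of a map\<close>

definition rel_forms :: "'a manifold \<Rightarrow> 'b manifold \<Rightarrow> nat \<Rightarrow> ('b form \<times> 'a form) set" where
  "rel_forms M N k = diff_forms N k \<times> (if k = 0 then {0} else diff_forms M (k - 1))"

definition rel_d ::
    "'a manifold \<Rightarrow> 'b manifold \<Rightarrow> ('a \<Rightarrow> 'b) \<Rightarrow> 'b form \<times> 'a form \<Rightarrow> 'b form \<times> 'a form" where
  "rel_d M N F = (\<lambda>(\<alpha>, \<beta>). (ext_deriv N \<alpha>, pullback M N F \<alpha> - ext_deriv M \<beta>))"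

definition rel_chains :: "'a manifold \<Rightarrow> 'b manifold \<Rightarrow> nat \<Rightarrow> ('b chain \<times> 'a chain) set" where
  "rel_chains M N k = smooth_chains N k \<times> (if k = 0 then {0} else smooth_chains M (k - 1))"

definition rel_boundary ::
    "('a \<Rightarrow> 'b) \<Rightarrow> nat \<Rightarrow> 'b chain \<times> 'a chain \<Rightarrow> 'b chain \<times> 'a chain" where
  "rel_boundary F k =
     (\<lambda>(S, T). (chain_boundary k S - chain_map (k - 1) F T, - chain_boundary (k - 1) T))"

definition rel_pairing ::
    "'a manifold \<Rightarrow> 'b manifold \<Rightarrow> nat \<Rightarrow> 'b form \<times> 'a form \<Rightarrow> 'b chain \<times> 'a chain \<Rightarrow> real" where
  "rel_pairing M N k =
     (\<lambda>(\<alpha>, \<beta>) (S, T). chain_integral N k S \<alpha> - chain_integral M (k - 1) T \<beta>)"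


section \<open>Cohomology and homology\<close>

text \<open>The real vector space \<open>Z/B\<close>, as a set of cosets. The fields \<open>mult\<close> and \<open>one\<close> that the module
  record inherits from rings carry no information.\<close>

definition quotient_space :: "'v::real_vector set \<Rightarrow> 'v set \<Rightarrow> (real, 'v set) module" where
  "quotient_space Z B =
     \<lparr>carrier = (\<lambda>z. z +o B) ` Z, mult = undefined, one = undefined,
      zero = B, add = (+), smult = (\<lambda>r X. (*\<^sub>R) r ` X + B)\<rparr>"

definition linear_isos :: "(real, 'v) module \<Rightarrow> (real, 'w) module \<Rightarrow> ('v \<Rightarrow> 'w) set" where
  "linear_isos V W = {f. bij_betw f (carrier V) (carrier W) \<and>
     (\<forall>x\<in>carrier V. \<forall>y\<in>carrier V. f (x \<oplus>\<^bsub>V\<^esub> y) = f x \<oplus>\<^bsub>W\<^esub> f y) \<and>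
     (\<forall>r. \<forall>x\<in>carrier V. f (r \<odot>\<^bsub>V\<^esub> x) = r \<odot>\<^bsub>W\<^esub> f x)}"

definition cohomology ::
    "(nat \<Rightarrow> 'v::real_vector set) \<Rightarrow> ('v \<Rightarrow> 'v) \<Rightarrow> nat \<Rightarrow> (real, 'v set) module" where
  "cohomology \<Omega> d k =
     quotient_space {z \<in> \<Omega> k. d z = 0} (if k = 0 then {0} else d ` \<Omega> (k - 1))"

definition de_rham :: "'a manifold \<Rightarrow> nat \<Rightarrow> (real, 'a form set) module" where
  "de_rham M = cohomology (diff_forms M) (ext_deriv M)"

text \<open>Cohomology, in degrees \<open>k \<ge> 0\<close>, of the de Rham complex augmented by the constants in
  degree \<open>-1\<close>.\<close>

definition reduced_de_rham :: "'a manifold \<Rightarrow> nat \<Rightarrow> (real, 'a form set) module" where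
  "reduced_de_rham M k =
     quotient_space {\<omega> \<in> diff_forms M k. ext_deriv M \<omega> = 0}
       (if k = 0 then range (const_form M) else ext_deriv M ` diff_forms M (k - 1))"

definition rel_cohomology ::
    "'a manifold \<Rightarrow> 'b manifold \<Rightarrow> ('a \<Rightarrow> 'b) \<Rightarrow> nat \<Rightarrow> (real, ('b form \<times> 'a form) set) module" where
  "rel_cohomology M N F = cohomology (rel_forms M N) (rel_d M N F)"

definition additive_group :: "'v::ab_group_add set \<Rightarrow> 'v monoid" where
  "additive_group Z = \<lparr>carrier = Z, mult = (+), one = 0\<rparr>"

definition chain_homology ::
    "(nat \<Rightarrow> 'v::ab_group_add set) \<Rightarrow> (nat \<Rightarrow> 'v \<Rightarrow> 'v) \<Rightarrow> nat \<Rightarrow> 'v set monoid" where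
  "chain_homology C bd k =
     additive_group {z \<in> C k. bd k z = 0} Mod (bd (Suc k) ` C (Suc k))"

definition smooth_homology :: "'a manifold \<Rightarrow> nat \<Rightarrow> 'a chain set monoid" where
  "smooth_homology N = chain_homology (smooth_chains N) chain_boundary"

definition rel_homology ::
    "'a manifold \<Rightarrow> 'b manifold \<Rightarrow> ('a \<Rightarrow> 'b) \<Rightarrow> nat \<Rightarrow> ('b chain \<times> 'a chain) set monoid" where
  "rel_homology M N F = chain_homology (rel_chains M N) (rel_boundary F)"

text \<open>The pairing of a cohomology class with a homology class induced by a pairing \<open>P\<close> of
  cochains with chains: the common value of \<open>P\<close> on all representatives (Stokes' theorem).\<close>

definition class_pairing :: "('v \<Rightarrow> 'c \<Rightarrow> real) \<Rightarrow> 'v set \<Rightarrow> 'c set \<Rightarrow> real" where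
  "class_pairing P A Z = (THE r. \<forall>\<omega>\<in>A. \<forall>z\<in>Z. P \<omega> z = r)"

end

theory Submission
  imports Defs
begin

text \<open>When one of the two manifolds is trivial, the relative complex of a map degenerates to a single
  factor, and every assertion follows by identifying that factor.

  If \<open>M\<close> is empty, all its charts are empty and it has no singular simplices, so the second factors of
  the relative forms and chains are zero (\<open>relative_complex_of_empty_source\<close>). The first projection
  is then injective on cocycles, coboundaries, cycles and boundaries. An additive map that is
  injective on a subgroup containing numerators and denominators induces an isomorphism of
  quotients by taking images of cosets (\<open>quotient_space_image_iso\<close>,
  \<open>additive_quotient_image_iso\<close>). Corresponding representatives pair to equal numbers, so
  the pairings of classes are characterized by equivalent conditions.

  If \<open>N\<close> is a point, openness of chart images forces its dimension to be zero (\<open>mdim_point\<close>). Hence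
  its forms of positive degree vanish, its functions are the constants, and the relative complex is
  the complex of \<open>M\<close> with differential \<open>-d\<close>, augmented by the pullback of constants
  (\<open>relative_complex_of_point_target\<close>). In degree zero the augmentation is injective once \<open>M\<close>
  has a point. In higher degrees the second projection identifies the cocycles with the closed forms; it
  identifies the coboundaries with the image of \<open>-d\<close>, or with the constants in the lowest degree.

  Analysis enters in the remaining step, that \<open>-d\<close> and \<open>d\<close> have the same image. This needs
  \<open>d(-\<omega>) = -d\<omega>\<close> (\<open>ext_deriv_uminus\<close>), hence the existence of the derivatives in all directions
  that occur in \<open>d\<close>, while smoothness is defined by partial derivatives only. Their existence follows
  from the continuity of the partial derivatives (\<open>C_infinity_on_has_dir_derivative\<close>).\<close>

section \<open>Quotients and injective additive maps\<close>

lemma image_set_plus: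
  assumes "\<And>x y. p (x + y) = p x + p y"
  shows "p ` (A + B) = p ` A + p ` B"
proof
  show "p ` (A + B) \<subseteq> p ` A + p ` B"
    by (auto simp: assms set_plus_intro elim!: set_plus_elim)
  show "p ` A + p ` B \<subseteq> p ` (A + B)"
    by (auto simp: set_plus_intro simp flip: assms elim!: set_plus_elim)
qed

lemma image_elt_set_plus:
  assumes "\<And>x y. p (x + y) = p x + p y"
  shows "p ` (z +o B) = p z +o p ` B"
proof -
  have "z +o B = (\<lambda>b. z + b) ` B" "p z +o p ` B = (\<lambda>b. p z + b) ` p ` B"
    by (auto simp: elt_set_plus_def)
  then show ?thesis
    by (simp add: image_image assms)
qed

text \<open>Both edge isomorphisms are induced by a coordinate projection that is injective on the cocycles and
  coboundaries, so taking images loses nothing.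
  Linearity of the projection carries the operations on cosets over.\<close>

lemma quotient_space_image_iso:
  assumes p: "linear p" and K: "subspace K" "inj_on p K" and "Z \<subseteq> K" "B \<subseteq> K"
  shows "(\<lambda>A. p ` A) \<in> linear_isos (quotient_space Z B) (quotient_space (p ` Z) (p ` B))"
proof -
  have add: "p (x + y) = p x + p y" for x y
    using p by (rule linear_add)
  have "z +o B \<subseteq> K" if "z \<in> Z" for z
    using that assms(4,5) K(1) by (auto simp: elt_set_plus_def subspace_add subset_iff)
  then have "inj_on (\<lambda>A. p ` A) ((\<lambda>z. z +o B) ` Z)"
    using K(2) by (intro inj_onI) (auto simp: inj_on_image_eq_iff)
  then have "bij_betw (\<lambda>A. p ` A) ((\<lambda>z. z +o B) ` Z) ((\<lambda>z. z +o p ` B) ` p ` Z)"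
    by (auto simp: bij_betw_def image_image image_elt_set_plus[OF add])
  moreover have "p ` ((*\<^sub>R) r ` A) = (*\<^sub>R) r ` p ` A" for r A
    by (auto simp: image_image linear_scale[OF p])
  ultimately show ?thesis
    by (simp add: linear_isos_def quotient_space_def image_set_plus[OF add])
qed

lemma linear_fst: "linear (fst :: 'x::real_vector \<times> 'y::real_vector \<Rightarrow> 'x)"
  and linear_snd: "linear (snd :: 'x::real_vector \<times> 'y::real_vector \<Rightarrow> 'y)"
  by (auto intro!: linearI)

lemma carrier_additive_quotient:
  "carrier (additive_group Z Mod B) = (\<lambda>z. B + {z}) ` Z" for Z :: "'c::ab_group_add set"
  by (auto simp: FactGroup_def RCOSETS_def r_coset_def additive_group_def set_plus_def)

lemma additive_quotient_image_iso:
  assumes add: "\<And>x y. p (x + y) = p x + p y"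
    and K: "\<And>x y. x \<in> K \<Longrightarrow> y \<in> K \<Longrightarrow> x + y \<in> K" "inj_on p K" and "Z \<subseteq> K" "B \<subseteq> K"
  shows "(\<lambda>A. p ` A) \<in> iso (additive_group Z Mod B) (additive_group (p ` Z) Mod (p ` B))"
proof -
  have mult: "A <#>\<^bsub>additive_group X\<^esub> C = A + C" for X A C :: "'c::ab_group_add set"
    by (auto simp: set_mult_def additive_group_def set_plus_def)
  have "B + {z} \<subseteq> K" if "z \<in> Z" for z
    using that assms(4,5) K(1) by (auto simp: set_plus_def subset_iff)
  then have "inj_on (\<lambda>A. p ` A) ((\<lambda>z. B + {z}) ` Z)"
    using K(2) by (intro inj_onI) (auto simp: inj_on_image_eq_iff)
  then have bij: "bij_betw (\<lambda>A. p ` A) ((\<lambda>z. B + {z}) ` Z) ((\<lambda>z. p ` B + {z}) ` p ` Z)"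
    by (auto simp: bij_betw_def image_image image_set_plus[of p, OF add])
  then show ?thesis
    by (auto simp: iso_def hom_def carrier_additive_quotient mult image_set_plus[of p, OF add] bij_betw_def)
qed

section \<open>Calculus on open subsets of coordinate space\<close>

lemma unit_vec_in_coord_space: "i < n \<Longrightarrow> unit_vec i \<in> coord_space n"
  by (auto simp: topspace_Euclidean_space unit_vec_def)

lemma coord_space_add_scale:
  "x \<in> coord_space n \<Longrightarrow> v \<in> coord_space n \<Longrightarrow> x + t *\<^sub>R v \<in> coord_space n"
  by (auto simp: topspace_Euclidean_space scaleR_fun_def)

text \<open>The topology of coordinate space is induced by the product topology on all sequences, whose basic
  open sets restrict finitely many coordinates; on points that vanish from \<open>n\<close> on, only the first
  \<open>n\<close> of them matter, and the least of the finitely many radii serves them all.\<close>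

lemma openin_Euclidean_space_box:
  assumes "openin (Euclidean_space n) V" "x \<in> V"
  obtains \<delta> where "\<delta> > 0"
    "\<And>y. y \<in> coord_space n \<Longrightarrow> (\<And>i. i < n \<Longrightarrow> \<bar>y i - x i\<bar> < \<delta>) \<Longrightarrow> y \<in> V"
proof -
  obtain U where U: "openin (powertop_real UNIV) U" "V = U \<inter> coord_space n"
    using assms(1) by (auto simp: Euclidean_space_def openin_subtopology)
  then obtain W where W: "x \<in> Pi UNIV W" "\<And>i. open (W i)" "Pi UNIV W \<subseteq> U"
    using product_topology_open_contains_basis[OF U(1), of x] assms(2)
    by (auto simp: PiE_UNIV_domain)
  have "\<exists>d>0. ball (x i) d \<subseteq> W i" for i
    using W(1,2) by (auto simp: open_contains_ball Pi_iff)
  then obtain d where d: "\<And>i. d i > 0" "\<And>i. ball (x i) (d i) \<subseteq> W i"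
    by metis
  define \<delta> where "\<delta> = Min (insert 1 (d ` {..<n}))"
  have le: "\<delta> \<le> d i" if "i < n" for i
    using that by (auto simp: \<delta>_def)
  show thesis
  proof
    show "\<delta> > 0"
      using d(1) by (auto simp: \<delta>_def)
    fix y assume y: "y \<in> coord_space n" "\<And>i. i < n \<Longrightarrow> \<bar>y i - x i\<bar> < \<delta>"
    have "y i \<in> W i" for i
    proof (cases "i < n")
      case True
      then have "y i \<in> ball (x i) (d i)"
        using y(2)[of i] le[of i] by (simp add: dist_real_def abs_minus_commute)
      then show ?thesis
        using d(2) by blast
    next
      case False
      then have "y i = x i"
        using y(1) assms(2) U(2) by (auto simp: topspace_Euclidean_space)
      then show ?thesis
        using W(1) by auto
    qed
    then show "y \<in> V"
      using W(3) U(2) y(1) by auto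
  qed
qed

lemma eventually_line_in_open:
  assumes "openin (Euclidean_space n) V" "x \<in> V" "v \<in> coord_space n"
  shows "\<forall>\<^sub>F t in nhds 0. x + t *\<^sub>R v \<in> V"
proof -
  obtain \<delta> where \<delta>: "\<delta> > 0"
    "\<And>y. y \<in> coord_space n \<Longrightarrow> (\<And>i. i < n \<Longrightarrow> \<bar>y i - x i\<bar> < \<delta>) \<Longrightarrow> y \<in> V"
    using openin_Euclidean_space_box[OF assms(1,2)] by metis
  have x: "x \<in> coord_space n"
    using assms(1,2) openin_subset by blast
  have "\<forall>\<^sub>F t in nhds 0. \<bar>t * v i\<bar> < \<delta>" for i
  proof -
    have "filterlim (\<lambda>t. \<bar>t * v i\<bar>) (nhds \<bar>0 * v i\<bar>) (nhds 0)"
      by (intro tendsto_intros filterlim_ident)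
    then show ?thesis
      using \<delta>(1) by (intro order_tendstoD) auto
  qed
  then have "\<forall>\<^sub>F t in nhds 0. \<forall>i\<in>{..<n}. \<bar>t * v i\<bar> < \<delta>"
    by (simp add: eventually_ball_finite)
  then show ?thesis
    by (rule eventually_mono) (rule \<delta>(2)[OF coord_space_add_scale[OF x assms(3)]], simp add: scaleR_fun_def)
qed

text \<open>Iterated partial derivatives are taken of functions on the whole space, and forms are set to \<open>0\<close>
  outside the chart images. Smoothness on an open set is insensitive to such extensions because
  short segments in coordinate directions stay in the set.\<close>

lemma iter_partial_cong_on:
  assumes V: "openin (Euclidean_space n) V" and eq: "\<And>x. x \<in> V \<Longrightarrow> f x = g x"
    and "set is \<subseteq> {..<n}" "x \<in> V"
  shows "iter_partial is f x = iter_partial is g x"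
  using assms(3,4)
proof (induction "is" arbitrary: x)
  case (Cons i "is")
  have "\<forall>\<^sub>F t in nhds 0. iter_partial is f (x + t *\<^sub>R unit_vec i) = iter_partial is g (x + t *\<^sub>R unit_vec i)"
    by (rule eventually_mono[OF eventually_line_in_open[OF V, of x "unit_vec i"]])
      (use Cons unit_vec_in_coord_space in auto)
  then show ?case
    by (simp add: dir_deriv_def deriv_cong_ev)
qed (use eq in auto)

lemma differentiable_along_line_cong:
  fixes f g :: "(nat \<Rightarrow> real) \<Rightarrow> real"
  assumes V: "openin (Euclidean_space n) V" and eq: "\<And>x. x \<in> V \<Longrightarrow> f x = g x"
    and "x \<in> V" "v \<in> coord_space n" "(\<lambda>t. f (x + t *\<^sub>R v)) differentiable at 0"
  shows "(\<lambda>t. g (x + t *\<^sub>R v)) differentiable at 0"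
proof -
  obtain D where D: "((\<lambda>t. f (x + t *\<^sub>R v)) has_real_derivative D) (at 0)"
    using assms(5) by (auto simp: real_differentiable_def)
  have "\<forall>\<^sub>F t in nhds 0. f (x + t *\<^sub>R v) = g (x + t *\<^sub>R v)"
    using eventually_line_in_open[OF V assms(3,4)] by (rule eventually_mono) (rule eq)
  then have "((\<lambda>t. g (x + t *\<^sub>R v)) has_real_derivative D) (at 0)"
    using D DERIV_cong_ev[of 0 0 "\<lambda>t. f (x + t *\<^sub>R v)" "\<lambda>t. g (x + t *\<^sub>R v)" D D] by auto
  then show ?thesis
    by (auto simp: real_differentiable_def)
qed

lemma C_infinity_on_cong:
  assumes V: "openin (Euclidean_space n) V" and eq: "\<And>x. x \<in> V \<Longrightarrow> f x = g x"
    and f: "C_infinity_on n V f"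
  shows "C_infinity_on n V g"
  unfolding C_infinity_on_def
proof (intro allI impI conjI ballI)
  fix js assume js: "set js \<subseteq> {..<n}"
  have *: "iter_partial js f x = iter_partial js g x" if "x \<in> V" for x
    using iter_partial_cong_on[OF V eq js that] .
  show "continuous_map (subtopology (Euclidean_space n) V) euclideanreal (iter_partial js g)"
    by (rule continuous_map_eq[where f = "iter_partial js f"])
      (use f js * in \<open>auto simp: C_infinity_on_def\<close>)
  fix i x assume i: "i < n" and x: "x \<in> V"
  then have "(\<lambda>t. iter_partial js f (x + t *\<^sub>R unit_vec i)) differentiable at 0"
    using f js unfolding C_infinity_on_def by blast
  then show "(\<lambda>t. iter_partial js g (x + t *\<^sub>R unit_vec i)) differentiable at 0"
    by (rule differentiable_along_line_cong[OF V _ x unit_vec_in_coord_space[OF i], rotated]) (rule *)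
qed

lemma iter_partial_const: "iter_partial is (\<lambda>_. r) = (\<lambda>_. if is = [] then r else 0)"
  by (induction "is") (auto simp: dir_deriv_def)

lemma C_infinity_on_const: "C_infinity_on n V (\<lambda>_. r)"
  by (auto simp: C_infinity_on_def iter_partial_const)

lemma iter_partial_uminus_on:
  assumes V: "openin (Euclidean_space n) V" and f: "C_infinity_on n V f"
    and "set is \<subseteq> {..<n}" "x \<in> V"
  shows "iter_partial is (\<lambda>y. - f y) x = - iter_partial is f x"
  using assms(3,4)
proof (induction "is" arbitrary: x)
  case (Cons i "is")
  then have i: "i < n" and js: "set is \<subseteq> {..<n}"
    by auto
  have "(\<lambda>t. iter_partial is f (x + t *\<^sub>R unit_vec i)) differentiable at 0"
    using f i js Cons.prems(2) by (auto simp: C_infinity_on_def)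
  then have *: "deriv (\<lambda>t. - iter_partial is f (x + t *\<^sub>R unit_vec i)) 0 = - deriv (\<lambda>t. iter_partial is f (x + t *\<^sub>R unit_vec i)) 0"
    by (intro DERIV_imp_deriv DERIV_minus) (simp add: DERIV_deriv_iff_real_differentiable)
  have "\<forall>\<^sub>F t in nhds 0. iter_partial is (\<lambda>y. - f y) (x + t *\<^sub>R unit_vec i) = - iter_partial is f (x + t *\<^sub>R unit_vec i)"
    by (rule eventually_mono[OF eventually_line_in_open[OF V Cons.prems(2) unit_vec_in_coord_space[OF i]]])
      (use Cons.IH js in auto)
  with * show ?case
    by (simp add: dir_deriv_def deriv_cong_ev)
qed auto

lemma C_infinity_on_uminus:
  assumes V: "openin (Euclidean_space n) V" and f: "C_infinity_on n V f"
  shows "C_infinity_on n V (\<lambda>x. - f x)"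
  unfolding C_infinity_on_def
proof (intro allI impI conjI ballI)
  fix js assume js: "set js \<subseteq> {..<n}"
  have *: "- iter_partial js f x = iter_partial js (\<lambda>x. - f x) x" if "x \<in> V" for x
    using iter_partial_uminus_on[OF V f js that] by simp
  show "continuous_map (subtopology (Euclidean_space n) V) euclideanreal (iter_partial js (\<lambda>x. - f x))"
    by (rule continuous_map_eq[where f = "\<lambda>x. - iter_partial js f x"])
      (use f js * in \<open>auto simp: C_infinity_on_def intro: continuous_map_minus\<close>)
  fix i x assume i: "i < n" and x: "x \<in> V"
  then have "(\<lambda>t. iter_partial js f (x + t *\<^sub>R unit_vec i)) differentiable at 0"
    using f js unfolding C_infinity_on_def by blast
  then have "(\<lambda>t. - iter_partial js f (x + t *\<^sub>R unit_vec i)) differentiable at 0"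
    by (rule differentiable_minus)
  then show "(\<lambda>t. iter_partial js (\<lambda>x. - f x) (x + t *\<^sub>R unit_vec i)) differentiable at 0"
    by (rule differentiable_along_line_cong[OF V _ x unit_vec_in_coord_space[OF i], rotated]) (rule *)
qed

text \<open>Smoothness as defined only speaks of partial derivatives, whereas the exterior derivative
  differentiates along arbitrary vectors. Continuity of the partial derivatives closes the gap: the
  step from \<open>x\<close> to \<open>x + t v\<close> is split into steps parallel to the axes, and the mean value theorem
  turns each of them into \<open>t v\<^sub>i\<close> times a partial derivative at a point near \<open>x\<close>.\<close>

lemma C_infinity_on_has_dir_derivative:
  assumes V: "openin (Euclidean_space n) V" and f: "C_infinity_on n V f"
    and x: "x \<in> V" and v: "v \<in> coord_space n"
  shows "((\<lambda>t. f (x + t *\<^sub>R v)) has_real_derivative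
    (\<Sum>i<n. v i * dir_deriv f x (unit_vec i))) (at 0)"
proof -
  \<comment> \<open>the corners of the path along the axes from \<open>0\<close> to \<open>v\<close>\<close>
  define w where "w k = (\<lambda>j. if j < k then v j else 0)" for k
  have x': "x \<in> coord_space n"
    using V x openin_subset by blast
  have w: "w 0 = 0" "w n = v" "\<And>k. w (Suc k) = w k + v k *\<^sub>R unit_vec k"
    using v by (auto simp: w_def fun_eq_iff topspace_Euclidean_space unit_vec_def scaleR_fun_def less_Suc_eq)
  have step: "filterlim (\<lambda>t. (f (x + t *\<^sub>R w (Suc i)) - f (x + t *\<^sub>R w i)) / t)
      (nhds (v i * dir_deriv f x (unit_vec i))) (at 0)" if i: "i < n" for i
  proof (rule tendstoI)
    fix e :: real assume e: "e > 0"
    define D where "D y = dir_deriv f y (unit_vec i)" for y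
    \<comment> \<open>The summand 1 covers \<open>v i = 0\<close>, and likewise for \<open>C\<close> when \<open>v = 0\<close>.\<close>
    define e' where "e' = e / (\<bar>v i\<bar> + 1)"
    have e': "e' > 0" "\<bar>v i\<bar> * e' < e"
      using e by (auto simp: e'_def field_simps)
    have der: "((\<lambda>r. f (y + r *\<^sub>R unit_vec i)) has_real_derivative D y) (at 0)" if "y \<in> V" for y
    proof -
      have "(\<lambda>r. f (y + r *\<^sub>R unit_vec i)) differentiable at 0"
        using f i that unfolding C_infinity_on_def by (force dest: spec[of _ "[]"])
      then show ?thesis
        by (simp add: D_def dir_deriv_def DERIV_deriv_iff_real_differentiable)
    qed
    have "continuous_map (subtopology (Euclidean_space n) V) euclideanreal (iter_partial [i] f)"
      using f i unfolding C_infinity_on_def by (metis empty_set lessThan_iff list.simps(15) empty_subsetI insert_subset)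
    then have cont: "continuous_map (subtopology (Euclidean_space n) V) euclideanreal D"
      by (simp add: D_def[abs_def])
    have "openin (subtopology (Euclidean_space n) V) {y \<in> topspace (subtopology (Euclidean_space n) V). D y \<in> ball (D x) e'}"
      using cont by (rule openin_continuous_map_preimage) simp
    then have U: "openin (Euclidean_space n) {y \<in> V. D y \<in> ball (D x) e'}"
      using V openin_subset[OF V] by (simp add: openin_open_subtopology Int_absorb1)
    obtain \<delta> where \<delta>: "\<delta> > 0"
      "\<And>y. y \<in> coord_space n \<Longrightarrow> (\<And>i. i < n \<Longrightarrow> \<bar>y i - x i\<bar> < \<delta>) \<Longrightarrow> y \<in> V \<and> D y \<in> ball (D x) e'"
      using openin_Euclidean_space_box[OF U, of x] x e'(1) by auto
    define C where "C = (\<Sum>j<n. \<bar>v j\<bar>) + 1"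
    have C: "C > 0"
      unfolding C_def by (intro add_nonneg_pos sum_nonneg) auto
    have v_le: "\<bar>v j\<bar> \<le> C" if "j < n" for j
      using member_le_sum[of j "{..<n}" "\<lambda>j. \<bar>v j\<bar>"] that by (simp add: C_def)
    have "\<forall>\<^sub>F t in at 0. \<bar>t\<bar> < \<delta> / C"
      using C \<delta>(1) by (auto simp: eventually_at dist_real_def intro!: exI[of _ "\<delta> / C"])
    moreover have "\<forall>\<^sub>F t :: real in at 0. t \<noteq> 0"
      by (simp add: eventually_at_filter)
    ultimately show "\<forall>\<^sub>F t in at 0. dist ((f (x + t *\<^sub>R w (Suc i)) - f (x + t *\<^sub>R w i)) / t)
        (v i * dir_deriv f x (unit_vec i)) < e"
    proof eventually_elim
      fix t :: real assume t: "\<bar>t\<bar> < \<delta> / C" "t \<noteq> 0"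
      define y where "y s = x + t *\<^sub>R w i + (s * t * v i) *\<^sub>R unit_vec i" for s
      have y: "y s \<in> V \<and> D (y s) \<in> ball (D x) e'" if s: "0 \<le> s" "s \<le> 1" for s
      proof (rule \<delta>(2))
        show "y s \<in> coord_space n"
          using x' v i by (auto simp: y_def w_def topspace_Euclidean_space unit_vec_def scaleR_fun_def)
        fix j assume j: "j < n"
        have "\<bar>y s j - x j\<bar> \<le> \<bar>t\<bar> * \<bar>v j\<bar>"
          using s by (auto simp: y_def w_def unit_vec_def scaleR_fun_def abs_mult mult_left_le_one_le mult.assoc)
        also have "\<dots> \<le> \<bar>t\<bar> * C"
          using v_le[OF j] by (intro mult_left_mono) auto
        also have "\<dots> < \<delta>"
          using t(1) C by (simp add: pos_less_divide_eq)
        finally show "\<bar>y s j - x j\<bar> < \<delta>" .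
      qed
      have "((\<lambda>s. f (y s)) has_real_derivative t * v i * D (y s)) (at s)" if s: "0 \<le> s" "s \<le> 1" for s
      proof -
        have *: "f (y s') = f (y s + (t * v i * (s' - s)) *\<^sub>R unit_vec i)" for s'
          by (rule arg_cong[of _ _ f]) (auto simp: y_def fun_eq_iff scaleR_fun_def algebra_simps)
        have "((\<lambda>r. f (y s + r *\<^sub>R unit_vec i)) has_real_derivative D (y s)) (at (t * v i * (s - s)))"
          using der y[OF s] by simp
        then have "((\<lambda>s'. f (y s + (t * v i * (s' - s)) *\<^sub>R unit_vec i)) has_real_derivative D (y s) * (t * v i)) (at s)"
          by (rule DERIV_chain2) (auto intro!: derivative_eq_intros)
        then show ?thesis
          by (subst *[abs_def]) (simp add: mult.commute)
      qed
      then obtain z where z: "0 < z" "z < 1" "f (y 1) - f (y 0) = (1 - 0) * (t * v i * D (y z))"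
        using MVT2[of 0 1 "\<lambda>s. f (y s)" "\<lambda>s. t * v i * D (y s)"] by auto
      have "y 1 = x + t *\<^sub>R w (Suc i)" "y 0 = x + t *\<^sub>R w i"
        by (auto simp: y_def w(3) fun_eq_iff scaleR_fun_def algebra_simps)
      then have "(f (x + t *\<^sub>R w (Suc i)) - f (x + t *\<^sub>R w i)) / t = v i * D (y z)"
        using z(3) t(2) by simp
      moreover have "dist (v i * D (y z)) (v i * D x) < e"
      proof -
        have "dist (v i * D (y z)) (v i * D x) = \<bar>v i\<bar> * dist (D (y z)) (D x)"
          by (simp add: dist_real_def flip: abs_mult right_diff_distrib)
        also have "\<dots> \<le> \<bar>v i\<bar> * e'"
          using y[of z] z by (intro mult_left_mono) (auto simp: dist_commute)
        finally show ?thesis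
          using e'(2) by simp
      qed
      ultimately show "dist ((f (x + t *\<^sub>R w (Suc i)) - f (x + t *\<^sub>R w i)) / t)
        (v i * dir_deriv f x (unit_vec i)) < e"
        by (simp add: D_def)
    qed
  qed
  have "(\<Sum>i<n. (f (x + t *\<^sub>R w (Suc i)) - f (x + t *\<^sub>R w i)) / t) = (f (x + t *\<^sub>R v) - f x) / t" for t
    using w(1,2) by (simp add: sum_lessThan_telescope[of "\<lambda>i. f (x + t *\<^sub>R w i)"] flip: sum_divide_distrib)
  moreover have "filterlim (\<lambda>t. \<Sum>i<n. (f (x + t *\<^sub>R w (Suc i)) - f (x + t *\<^sub>R w i)) / t)
      (nhds (\<Sum>i<n. v i * dir_deriv f x (unit_vec i))) (at 0)"
    by (intro tendsto_sum step) auto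
  ultimately show ?thesis
    by (simp add: has_field_derivative_iff)
qed

lemma dir_deriv_const: "dir_deriv (\<lambda>y. r) x v = 0"
  by (simp add: dir_deriv_def)

text \<open>Differentiability is essential: \<^const>\<open>deriv\<close> of a function that is not differentiable is an arbitrary
  but fixed number, which need not change sign with the function.\<close>

lemma dir_deriv_uminus:
  assumes "openin (Euclidean_space n) V" "C_infinity_on n V f" "x \<in> V" "v \<in> coord_space n"
  shows "dir_deriv (\<lambda>y. - f y) x v = - dir_deriv f x v"
  using C_infinity_on_has_dir_derivative[OF assms]
  by (auto simp: dir_deriv_def DERIV_imp_deriv intro!: DERIV_imp_deriv DERIV_minus)

section \<open>Charts\<close>

lemma openin_chart_image:
  "smooth_manifold M \<Longrightarrow> c \<in> matlas M \<Longrightarrow> openin (Euclidean_space (mdim M)) (chart_image c)"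
  by (simp add: smooth_manifold_def)

lemma chart_domain_subset:
  "smooth_manifold M \<Longrightarrow> c \<in> matlas M \<Longrightarrow> fst c \<subseteq> topspace (mtop M)"
  by (auto simp: smooth_manifold_def)

lemma chart_inv_in_domain: "x \<in> chart_image c \<Longrightarrow> chart_inv c x \<in> fst c"
  by (simp add: chart_image_def chart_inv_def inv_into_into)

lemma chart_chart_inv: "x \<in> chart_image c \<Longrightarrow> snd c (chart_inv c x) = x"
  by (simp add: chart_image_def chart_inv_def f_inv_into_f)

lemma chart_in_image: "p \<in> fst c \<Longrightarrow> snd c p \<in> chart_image c"
  by (simp add: chart_image_def)

lemma chart_inv_chart:
  assumes "smooth_manifold M" "c \<in> matlas M" "p \<in> fst c"
  shows "chart_inv c (snd c p) = p"
proof -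
  have "homeomorphic_map (subtopology (mtop M) (fst c))
          (subtopology (Euclidean_space (mdim M)) (chart_image c)) (snd c)"
    using assms by (simp add: smooth_manifold_def)
  then have "inj_on (snd c) (topspace (mtop M) \<inter> fst c)"
    by (simp add: homeomorphic_map_def)
  then have "inj_on (snd c) (fst c)"
    using chart_domain_subset[OF assms(1,2)] by (simp add: Int_absorb1)
  then show ?thesis
    using assms(3) by (simp add: chart_inv_def)
qed

lemma chart_at:
  assumes "smooth_manifold M" "p \<in> topspace (mtop M)"
  shows "chart_at M p \<in> matlas M" "p \<in> fst (chart_at M p)"
proof -
  have "\<exists>c. c \<in> matlas M \<and> p \<in> fst c"
    using assms unfolding smooth_manifold_def by blast
  then have "chart_at M p \<in> matlas M \<and> p \<in> fst (chart_at M p)"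
    unfolding chart_at_def by (rule someI_ex)
  then show "chart_at M p \<in> matlas M" "p \<in> fst (chart_at M p)"
    by auto
qed

section \<open>Differential forms and their exterior derivative\<close>

lemma diff_forms_outside:
  "\<omega> \<in> diff_forms M k \<Longrightarrow> \<not> (c \<in> matlas M \<and> x \<in> chart_image c \<and> vs \<in> vec_tuples (mdim M) k) \<Longrightarrow>
    \<omega> c x vs = 0"
  unfolding diff_forms_def by blast

lemma diff_forms_C_infinity:
  "\<omega> \<in> diff_forms M k \<Longrightarrow> c \<in> matlas M \<Longrightarrow> vs \<in> vec_tuples (mdim M) k \<Longrightarrow>
    C_infinity_on (mdim M) (chart_image c) (\<lambda>x. \<omega> c x vs)"
  by (simp add: diff_forms_def)

lemma zero_in_diff_forms: "0 \<in> diff_forms M k"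
  by (simp add: diff_forms_def alternating_multilinear_def C_infinity_on_const)

lemma uminus_in_diff_forms:
  assumes "smooth_manifold M" "\<omega> \<in> diff_forms M k"
  shows "- \<omega> \<in> diff_forms M k"
proof -
  have "alternating_multilinear n k (- A)" if "alternating_multilinear n k A" for n A
    using that by (simp add: alternating_multilinear_def)
  moreover have "C_infinity_on (mdim M) (chart_image c) (\<lambda>x. - \<omega> c x vs)"
    if "c \<in> matlas M" "vs \<in> vec_tuples (mdim M) k" for c vs
    using C_infinity_on_uminus[OF openin_chart_image[OF assms(1) that(1)] diff_forms_C_infinity[OF assms(2) that]] .
  ultimately show ?thesis
    using assms(2) by (simp add: diff_forms_def)
qed

lemma ext_deriv_zero: "ext_deriv M 0 = 0"
  by (simp add: ext_deriv_def fun_eq_iff dir_deriv_const)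

text \<open>This turns the differential \<open>-d\<close> of the source edge into \<open>d\<close> without changing its image. The directional
  derivatives in question exist only when the list of remaining vectors has the degree of the form;
  for other lists the form vanishes identically.\<close>

lemma ext_deriv_uminus:
  assumes M: "smooth_manifold M" and \<omega>: "\<omega> \<in> diff_forms M k"
  shows "ext_deriv M (- \<omega>) = - ext_deriv M \<omega>"
proof -
  have "dir_deriv (\<lambda>y. - \<omega> c y ws) x v = - dir_deriv (\<lambda>y. \<omega> c y ws) x v"
    if "c \<in> matlas M" "x \<in> chart_image c" "v \<in> coord_space (mdim M)" for c x v ws
  proof (cases "ws \<in> vec_tuples (mdim M) k")
    case True
    then show ?thesis
      using dir_deriv_uminus[OF openin_chart_image[OF M that(1)] diff_forms_C_infinity[OF \<omega> that(1) True] that(2,3)]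
      by simp
  next
    case False
    then have "\<omega> c y ws = 0" for y
      using diff_forms_outside[OF \<omega>] by blast
    then show ?thesis
      by (simp add: dir_deriv_const)
  qed
  then show ?thesis
    by (auto simp: ext_deriv_def fun_eq_iff sum_negf[symmetric] subset_iff intro!: sum.cong)
qed

section \<open>Functions as forms of degree zero\<close>

lemma function_form_in_diff_forms:
  assumes M: "smooth_manifold M"
    and f: "\<And>c. c \<in> matlas M \<Longrightarrow> C_infinity_on (mdim M) (chart_image c) (f \<circ> chart_inv c)"
  shows "function_form M f \<in> diff_forms M 0"
proof -
  have *: "function_form M f c x [] = f (chart_inv c x)" if "c \<in> matlas M" "x \<in> chart_image c" for c x
    using that by (simp add: function_form_def)
  have vt: "vec_tuples n 0 = {[]}" for n
    by (auto simp: vec_tuples_def)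
  have "C_infinity_on (mdim M) (chart_image c) (\<lambda>x. function_form M f c x [])" if "c \<in> matlas M" for c
    by (rule C_infinity_on_cong[OF openin_chart_image[OF M that] _ f[OF that]]) (simp add: * that)
  moreover have "function_form M f c x [] = function_form M f c' (snd c' (chart_inv c x)) []"
    if c: "c \<in> matlas M" "c' \<in> matlas M" and x: "x \<in> snd c ` (fst c \<inter> fst c')" for c c' x
  proof -
    obtain p where p: "p \<in> fst c" "p \<in> fst c'" "x = snd c p"
      using x by auto
    then show ?thesis
      using c by (simp add: * chart_in_image chart_inv_chart[OF M])
  qed
  ultimately show ?thesis
    by (auto simp: diff_forms_def vt alternating_multilinear_def function_form_def)
qed

text \<open>For surjectivity the value of the function at a point is read off in any chart around it: on the
  empty list of vectors, compatibility under transition maps says that the charts agree.\<close>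

lemma bij_betw_function_form:
  assumes M: "smooth_manifold M"
  shows "bij_betw (function_form M) (smooth_functions M) (diff_forms M 0)"
  unfolding bij_betw_def
proof
  show "inj_on (function_form M) (smooth_functions M)"
  proof (rule inj_onI)
    fix f g assume fg: "f \<in> smooth_functions M" "g \<in> smooth_functions M"
      and eq: "function_form M f = function_form M g"
    have "f p = g p" if p: "p \<in> topspace (mtop M)" for p
    proof -
      let ?c = "chart_at M p"
      note c = chart_at[OF M p]
      have "function_form M f ?c (snd ?c p) [] = function_form M g ?c (snd ?c p) []"
        by (simp add: eq)
      then show ?thesis
        using c by (simp add: function_form_def chart_in_image chart_inv_chart[OF M])
    qed
    then show "f = g"
      using fg by (auto simp: smooth_functions_def intro: extensionalityI)
  qed
  have "\<omega> \<in> function_form M ` smooth_functions M" if \<omega>: "\<omega> \<in> diff_forms M 0" for \<omega>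
  proof -
    define f where "f = restrict (\<lambda>p. \<omega> (chart_at M p) (snd (chart_at M p) p) []) (topspace (mtop M))"
    have f: "\<omega> c x [] = f (chart_inv c x)" if c: "c \<in> matlas M" and x: "x \<in> chart_image c" for c x
    proof -
      define p where "p = chart_inv c x"
      have p: "p \<in> fst c" "snd c p = x"
        using x by (simp_all add: p_def chart_inv_in_domain chart_chart_inv)
      have pM: "p \<in> topspace (mtop M)"
        using p(1) chart_domain_subset[OF M c] by blast
      have "x \<in> snd c ` (fst c \<inter> fst (chart_at M p))"
        using p chart_at(2)[OF M pM] by blast
      moreover have "[] \<in> vec_tuples (mdim M) 0"
        by (simp add: vec_tuples_def)
      ultimately have "\<omega> c x [] = \<omega> (chart_at M p) (snd (chart_at M p) (chart_inv c x)) (map (push_vec (snd (chart_at M p) \<circ> chart_inv c) x) [])"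
        using \<omega> c chart_at(1)[OF M pM] unfolding diff_forms_def by blast
      then show ?thesis
        using pM by (simp add: f_def p_def)
    qed
    have "C_infinity_on (mdim M) (chart_image c) (f \<circ> chart_inv c)" if c: "c \<in> matlas M" for c
      by (rule C_infinity_on_cong[OF openin_chart_image[OF M c] _ diff_forms_C_infinity[OF \<omega> c, of "[]"]])
        (simp_all add: f c vec_tuples_def)
    then have "f \<in> smooth_functions M"
      by (simp add: smooth_functions_def f_def)
    moreover have "\<omega> = function_form M f"
      using diff_forms_outside[OF \<omega>] f by (auto simp: function_form_def fun_eq_iff vec_tuples_def)
    ultimately show ?thesis
      by blast
  qed
  then show "function_form M ` smooth_functions M = diff_forms M 0"
    using function_form_in_diff_forms[OF M] by (auto simp: smooth_functions_def)
qed

lemma const_form_in_diff_forms: "smooth_manifold M \<Longrightarrow> const_form M r \<in> diff_forms M 0"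
  unfolding const_form_def
  by (rule function_form_in_diff_forms) (simp_all add: comp_def C_infinity_on_const)

lemma linear_const_form: "linear (const_form M)"
  by (rule linearI) (auto simp: const_form_def function_form_def fun_eq_iff scaleR_fun_def)

lemma const_form_chart:
  assumes M: "smooth_manifold M" and p: "p \<in> topspace (mtop M)"
  shows "const_form M r (chart_at M p) (snd (chart_at M p) p) [] = r"
  using chart_at[OF M p] by (simp add: const_form_def function_form_def chart_in_image)

lemma inj_const_form:
  assumes M: "smooth_manifold M" and "topspace (mtop M) \<noteq> {}"
  shows "inj (const_form M)"
proof -
  obtain p where p: "p \<in> topspace (mtop M)"
    using assms(2) by blast
  show ?thesis
    by (rule injI) (metis const_form_chart[OF M p])
qed

lemma pullback_const_form:
  assumes M: "smooth_manifold M" and N: "smooth_manifold N" and F: "smooth_map M N F"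
  shows "pullback M N F (const_form N r) = const_form M r"
proof -
  have "const_form N r (chart_at N (F (chart_inv c x))) (snd (chart_at N (F (chart_inv c x))) (F (chart_inv c x))) vs
      = (if vs = [] then r else 0)" if c: "c \<in> matlas M" and x: "x \<in> chart_image c" for c x vs
  proof -
    have "continuous_map (subtopology (Euclidean_space (mdim M)) (chart_image c)) (mtop N) (F \<circ> chart_inv c)"
      using F c by (simp add: smooth_map_def smooth_from_coords_def)
    moreover have "x \<in> topspace (subtopology (Euclidean_space (mdim M)) (chart_image c))"
      using x openin_subset[OF openin_chart_image[OF M c]] by auto
    ultimately have "F (chart_inv c x) \<in> topspace (mtop N)"
      by (auto simp: continuous_map_def)
    from const_form_chart[OF N this] show ?thesis
      by (simp add: const_form_def function_form_def)
  qed
  then show ?thesis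
    by (auto simp: fun_eq_iff pullback_def pullback_at_def Let_def) 
      (auto simp: const_form_def function_form_def)
qed

lemma pullback_zero: "pullback M N F 0 = 0"
  by (simp add: pullback_def pullback_at_def fun_eq_iff Let_def)

lemma chain_integral_zero_form: "chain_integral N k S 0 = 0"
  by (simp add: chain_integral_def simplex_integral_def pullback_at_def Let_def)

lemma chain_integral_zero_chain: "chain_integral N k 0 \<omega> = 0"
  by (simp add: chain_integral_def)

section \<open>The empty manifold and the point\<close>

lemma no_chart_point_empty:
  assumes "smooth_manifold M" "topspace (mtop M) = {}" "c \<in> matlas M"
  shows "chart_image c = {}"
  using chart_domain_subset[OF assms(1,3)] assms(2) by (simp add: chart_image_def)

lemma diff_forms_empty:
  assumes "smooth_manifold M" "topspace (mtop M) = {}"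
  shows "diff_forms M k = {0}"
proof -
  have "\<omega> = 0" if "\<omega> \<in> diff_forms M k" for \<omega>
    using diff_forms_outside[OF that] no_chart_point_empty[OF assms] by (fastforce simp: fun_eq_iff)
  then show ?thesis
    using zero_in_diff_forms by blast
qed

lemma pullback_empty:
  assumes "smooth_manifold M" "topspace (mtop M) = {}"
  shows "pullback M N F \<alpha> = 0"
  using no_chart_point_empty[OF assms] by (auto simp: pullback_def fun_eq_iff)

lemma smooth_chains_empty:
  assumes "topspace (mtop M) = {}"
  shows "smooth_chains M k = {0}"
proof -
  have "\<not> smooth_simplex k M \<sigma>" for \<sigma>
    using assms nonempty_standard_simplex[of k]
    by (auto simp: smooth_simplex_def singular_simplex_def continuous_map_def)
  then have "Collect (smooth_simplex k M) = {}"
    by blast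
  then show ?thesis
    by (simp only: smooth_chains_def subset_empty keys_eq_empty singleton_conv)
qed

text \<open>A chart domain around the point is a single point, whose image is open. In positive dimension an open set
  contains a short segment around each of its points, so it is never a single point.\<close>

lemma mdim_point:
  assumes N: "smooth_manifold N" and p: "topspace (mtop N) = {p}"
  shows "mdim N = 0"
proof (rule ccontr)
  assume n: "mdim N \<noteq> 0"
  let ?c = "chart_at N p" and ?n = "mdim N"
  have c: "?c \<in> matlas N" "p \<in> fst ?c"
    using chart_at[OF N, of p] p by auto
  then have "fst ?c = {p}"
    using chart_domain_subset[OF N c(1)] p by blast
  then have im: "chart_image ?c = {snd ?c p}"
    by (simp add: chart_image_def)
  have "openin (Euclidean_space ?n) {snd ?c p}"
    using openin_chart_image[OF N c(1)] im by simp
  from eventually_line_in_open[OF this _ unit_vec_in_coord_space[of 0]] n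
  have "\<forall>\<^sub>F t in nhds 0. snd ?c p + t *\<^sub>R unit_vec 0 = snd ?c p"
    by simp
  then have "\<forall>\<^sub>F t :: real in nhds 0. t = 0"
    by (rule eventually_mono) (auto simp: fun_eq_iff unit_vec_def scaleR_fun_def split: if_splits)
  \<comment> \<open>but \<open>0\<close> is not isolated on the real line\<close>
  then show False
    using eventually_at_filter[of "\<lambda>t. False" "0::real" UNIV] by (simp add: trivial_limit_def[symmetric])
qed

lemma coord_space_0: "coord_space 0 = {0}"
  by (auto simp: topspace_Euclidean_space)

text \<open>Every argument of a form on zero-dimensional space is the zero vector, at which a form that is linear
  in its first argument vanishes.\<close>

lemma diff_forms_dim_0:
  assumes n: "mdim N = 0" and k: "k \<ge> 1"
  shows "diff_forms N k = {0}"
proof -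
  have "\<omega> c x vs = 0" if \<omega>: "\<omega> \<in> diff_forms N k" for \<omega> c x vs
  proof (cases "c \<in> matlas N \<and> x \<in> chart_image c \<and> vs \<in> vec_tuples (mdim N) k")
    case True
    then have vs: "vs \<in> vec_tuples 0 k" and "alternating_multilinear 0 k (\<omega> c x)"
      using \<omega> n by (auto simp: diff_forms_def)
    then have "\<omega> c x (vs[0 := a *\<^sub>R 0 + b *\<^sub>R 0]) = a * \<omega> c x (vs[0 := 0]) + b * \<omega> c x (vs[0 := 0])" for a b
      using k unfolding alternating_multilinear_def coord_space_0 by force
    \<comment> \<open>the zero vector as the linear combination with both coefficients zero\<close>
    from this[of 0 0] have "\<omega> c x (vs[0 := 0]) = 0"
      by simp
    moreover have "vs ! 0 = 0"
      using vs k by (auto simp: vec_tuples_def coord_space_0 subset_iff)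
    ultimately show ?thesis
      by (metis list_update_id)
  qed (use diff_forms_outside[OF \<omega>] in blast)
  then show ?thesis
    using zero_in_diff_forms by (fastforce simp: fun_eq_iff)
qed

lemma ext_deriv_dim_0:
  assumes n: "mdim N = 0"
  shows "ext_deriv N \<omega> = 0"
proof -
  have "dir_deriv f x (vs ! i) = 0" if "set vs \<subseteq> coord_space 0" "i < length vs" for f x i vs
  proof -
    have "vs ! i = 0"
      using that by (auto simp: coord_space_0 subset_iff)
    then show ?thesis
      by (simp add: dir_deriv_def)
  qed
  then show ?thesis
    by (auto simp: ext_deriv_def n fun_eq_iff intro!: sum.neutral)
qed

text \<open>Forms of degree zero are functions, and all functions on a point are constant.\<close>

lemma diff_forms_point:
  assumes N: "smooth_manifold N" and p: "topspace (mtop N) = {p}"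
  shows "diff_forms N 0 = range (const_form N)"
proof
  show "range (const_form N) \<subseteq> diff_forms N 0"
    using const_form_in_diff_forms[OF N] by blast
  have "function_form N f = const_form N (f p)" for f
  proof -
    have "chart_inv c x = p" if "c \<in> matlas N" "x \<in> chart_image c" for c x
      using chart_inv_in_domain[OF that(2)] chart_domain_subset[OF N that(1)] p by blast
    then show ?thesis
      by (auto simp: const_form_def function_form_def fun_eq_iff)
  qed
  then have "function_form N ` smooth_functions N \<subseteq> range (const_form N)"
    by auto
  then show "diff_forms N 0 \<subseteq> range (const_form N)"
    using bij_betw_imp_surj_on[OF bij_betw_function_form[OF N]] by simp
qed

section \<open>The two edges\<close>

lemma relative_complex_of_empty_source:
  fixes M :: "'a manifold" and N :: "'b manifold" and F :: "'a \<Rightarrow> 'b"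
  assumes M: "smooth_manifold M" and empty: "topspace (mtop M) = {}"
  shows "rel_forms M N k = diff_forms N k \<times> {0}"
    and "rel_d M N F (\<alpha>, 0) = (ext_deriv N \<alpha>, 0)"
    and "rel_chains M N k = smooth_chains N k \<times> {0}"
    and "rel_boundary F k (S, 0) = (chain_boundary k S, 0)"
    and "rel_pairing M N k (\<alpha>, 0) (S, 0) = chain_integral N k S \<alpha>"
  by (simp_all add: rel_forms_def diff_forms_empty[OF M empty] rel_d_def pullback_empty[OF M empty]
      ext_deriv_zero rel_chains_def smooth_chains_empty[OF empty] rel_boundary_def rel_pairing_def
      chain_integral_zero_chain)

lemma target_edge:
  fixes M :: "'a manifold" and N :: "'b manifold" and F :: "'a \<Rightarrow> 'b"
  assumes M: "smooth_manifold M" and empty: "topspace (mtop M) = {}"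
  shows "(\<lambda>A. fst ` A) \<in> linear_isos (rel_cohomology M N F k) (de_rham N k)" (is ?coh)
    and "(\<lambda>Z. fst ` Z) \<in> iso (rel_homology M N F k) (smooth_homology N k)" (is ?hom)
    and "A \<in> carrier (rel_cohomology M N F k) \<Longrightarrow> Z \<in> carrier (rel_homology M N F k) \<Longrightarrow>
      class_pairing (rel_pairing M N k) A Z =
      class_pairing (\<lambda>\<alpha> S. chain_integral N k S \<alpha>) (fst ` A) (fst ` Z)"
proof -
  note rel = relative_complex_of_empty_source[OF M empty]
  let ?Z = "{\<alpha> \<in> diff_forms N k. ext_deriv N \<alpha> = 0}"
  let ?B = "if k = 0 then {0} else ext_deriv N ` diff_forms N (k - 1)"
  have Z: "{z \<in> rel_forms M N k. rel_d M N F z = 0} = ?Z \<times> {0}"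
    by (auto simp: rel zero_prod_def)
  have B: "(if k = 0 then {0} else rel_d M N F ` rel_forms M N (k - 1)) = ?B \<times> {0}"
    by (auto simp: rel zero_prod_def image_iff)
  have coh: "rel_cohomology M N F k = quotient_space (?Z \<times> {0}) (?B \<times> {0})"
    unfolding rel_cohomology_def cohomology_def Z B ..
  have "(\<lambda>A. fst ` A) \<in> linear_isos (quotient_space (?Z \<times> {0 :: 'a form}) (?B \<times> {0 :: 'a form}))
      (quotient_space (fst ` (?Z \<times> {0 :: 'a form})) (fst ` (?B \<times> {0 :: 'a form})))"
    by (rule quotient_space_image_iso[OF linear_fst, where K = "UNIV \<times> {0}"])
      (auto simp: subspace_def zero_prod_def inj_on_def)
  then show ?coh
    by (simp add: coh de_rham_def cohomology_def)
  let ?ZC = "{S \<in> smooth_chains N k. chain_boundary k S = 0}"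
  let ?BC = "chain_boundary (Suc k) ` smooth_chains N (Suc k)"
  have ZC: "{z \<in> rel_chains M N k. rel_boundary F k z = 0} = ?ZC \<times> {0}"
    by (auto simp: rel zero_prod_def)
  have BC: "rel_boundary F (Suc k) ` rel_chains M N (Suc k) = ?BC \<times> {0}"
    by (auto simp: rel image_iff)
  have hom: "rel_homology M N F k = additive_group (?ZC \<times> {0}) Mod (?BC \<times> {0})"
    unfolding rel_homology_def chain_homology_def ZC BC ..
  have "(\<lambda>A. fst ` A) \<in> iso (additive_group (?ZC \<times> {0 :: 'a chain}) Mod (?BC \<times> {0 :: 'a chain}))
      (additive_group (fst ` (?ZC \<times> {0 :: 'a chain})) Mod (fst ` (?BC \<times> {0 :: 'a chain})))"
    by (rule additive_quotient_image_iso[where K = "UNIV \<times> {0}"])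
      (auto simp: zero_prod_def inj_on_def)
  then show ?hom
    by (simp add: hom smooth_homology_def chain_homology_def)
  assume A: "A \<in> carrier (rel_cohomology M N F k)" and Z: "Z \<in> carrier (rel_homology M N F k)"
  have "snd \<omega> = 0" if "\<omega> \<in> A" for \<omega>
    using A that by (auto simp: coh quotient_space_def elt_set_plus_def split: if_splits)
  then have A': "(fst \<omega>, 0) = \<omega>" if "\<omega> \<in> A" for \<omega>
    using that by (simp add: prod_eq_iff)
  have "snd z = 0" if "z \<in> Z" for z
    using Z that by (auto simp: hom carrier_additive_quotient set_plus_def)
  then have Z': "(fst z, 0) = z" if "z \<in> Z" for z
    using that by (simp add: prod_eq_iff)
  have "rel_pairing M N k \<omega> z = chain_integral N k (fst z) (fst \<omega>)" if "\<omega> \<in> A" "z \<in> Z" for \<omega> z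
    using rel(5)[where k = k and N = N and \<alpha> = "fst \<omega>" and S = "fst z"] by (simp only: A'[OF that(1)] Z'[OF that(2)])
  then have "(\<forall>\<omega>\<in>A. \<forall>z\<in>Z. rel_pairing M N k \<omega> z = r) \<longleftrightarrow>
      (\<forall>\<alpha>\<in>fst ` A. \<forall>S\<in>fst ` Z. chain_integral N k S \<alpha> = r)" for r
    by auto
  then show "class_pairing (rel_pairing M N k) A Z =
      class_pairing (\<lambda>\<alpha> S. chain_integral N k S \<alpha>) (fst ` A) (fst ` Z)"
    by (simp only: class_pairing_def)
qed

lemma relative_complex_of_point_target:
  fixes M :: "'a manifold" and N :: "'b manifold" and F :: "'a \<Rightarrow> 'b"
  assumes M: "smooth_manifold M" and N: "smooth_manifold N" and F: "smooth_map M N F"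
    and p: "topspace (mtop N) = {p}"
  shows "rel_forms M N 0 = (\<lambda>c. (const_form N c, 0)) ` UNIV"
    and "k \<ge> 1 \<Longrightarrow> rel_forms M N k = {0} \<times> diff_forms M (k - 1)"
    and "rel_d M N F (const_form N c, 0) = (0, const_form M c)"
    and "rel_d M N F (0, \<beta>) = (0, - ext_deriv M \<beta>)"
  using diff_forms_point[OF N p] diff_forms_dim_0[OF mdim_point[OF N p]]
  by (auto simp: rel_forms_def rel_d_def pullback_const_form[OF M N F] pullback_zero ext_deriv_zero
      ext_deriv_dim_0[OF mdim_point[OF N p]])

lemma source_edge:
  fixes M :: "'a manifold" and N :: "'b manifold" and F :: "'a \<Rightarrow> 'b"
  assumes M: "smooth_manifold M" and N: "smooth_manifold N" and F: "smooth_map M N F"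
    and p: "topspace (mtop N) = {p}"
  shows "topspace (mtop M) \<noteq> {} \<Longrightarrow>
      carrier (rel_cohomology M N F 0) = {\<zero>\<^bsub>rel_cohomology M N F 0\<^esub>}"
    and "k \<ge> 1 \<Longrightarrow> (\<lambda>A. snd ` A) \<in> linear_isos (rel_cohomology M N F k) (reduced_de_rham M (k - 1))"
proof -
  note rel = relative_complex_of_point_target[OF M N F p]
  have const_0: "const_form L 0 = 0" for L :: "'c manifold"
    by (rule linear_0[OF linear_const_form])
  show "carrier (rel_cohomology M N F 0) = {\<zero>\<^bsub>rel_cohomology M N F 0\<^esub>}"
    if "topspace (mtop M) \<noteq> {}"
  proof -
    have kernel: "const_form M c = 0 \<longleftrightarrow> c = 0" for c
      using inj_eq[OF inj_const_form[OF M that], of c 0] by (simp add: const_0)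
    have "{z \<in> rel_forms M N 0. rel_d M N F z = 0} =
        (\<lambda>c. (const_form N c, 0)) ` {c. const_form M c = 0}"
      unfolding rel(1) by (auto simp: rel(3) zero_prod_def)
    also have "\<dots> = {0}"
      by (simp add: kernel const_0 zero_prod_def)
    finally have "{z \<in> rel_forms M N 0. rel_d M N F z = 0} = {0}" .
    then show ?thesis
      by (simp add: rel_cohomology_def cohomology_def quotient_space_def elt_set_plus_def)
  qed
  assume k: "k \<ge> 1"
  let ?Z = "{\<omega> \<in> diff_forms M (k - 1). ext_deriv M \<omega> = 0}"
  let ?B = "if k - 1 = 0 then range (const_form M) else ext_deriv M ` diff_forms M (k - 1 - 1)"
  have Z: "{z \<in> rel_forms M N k. rel_d M N F z = 0} = {0} \<times> ?Z"
    by (auto simp: rel(2)[OF k] rel(4) zero_prod_def)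
  have B: "(if k = 0 then {0} else rel_d M N F ` rel_forms M N (k - 1)) = {0} \<times> ?B"
  proof (cases "k = 1")
    case True
    then show ?thesis
      by (auto simp: rel(1,3) image_image)
  next
    case False
    then have "k - 1 \<ge> 1"
      using k by simp
    \<comment> \<open>Both inclusions of images are witnessed by \<open>- \<beta>\<close>.\<close>
    have "ext_deriv M \<beta> \<in> (\<lambda>\<beta>. - ext_deriv M \<beta>) ` diff_forms M (k - 1 - 1)"
      if "\<beta> \<in> diff_forms M (k - 1 - 1)" for \<beta>
      by (rule image_eqI[of _ _ "- \<beta>"]) (simp_all only: ext_deriv_uminus[OF M that] uminus_in_diff_forms[OF M that] minus_minus)
    moreover have "- ext_deriv M \<beta> \<in> ext_deriv M ` diff_forms M (k - 1 - 1)"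
      if "\<beta> \<in> diff_forms M (k - 1 - 1)" for \<beta>
      by (rule image_eqI[of _ _ "- \<beta>"]) (simp_all only: ext_deriv_uminus[OF M that] uminus_in_diff_forms[OF M that])
    ultimately have "(\<lambda>\<beta>. - ext_deriv M \<beta>) ` diff_forms M (k - 1 - 1) = ext_deriv M ` diff_forms M (k - 1 - 1)"
      by blast
    moreover have "rel_d M N F ` ({0} \<times> D) = {0} \<times> (\<lambda>\<beta>. - ext_deriv M \<beta>) ` D" for D
      by (auto simp: rel(4) image_iff)
    ultimately have "rel_d M N F ` rel_forms M N (k - 1) = {0} \<times> ext_deriv M ` diff_forms M (k - 1 - 1)"
      by (simp only: rel(2)[OF \<open>k - 1 \<ge> 1\<close>])
    then show ?thesis
      using False k by simp
  qed
  have coh: "rel_cohomology M N F k = quotient_space ({0} \<times> ?Z) ({0} \<times> ?B)"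
    unfolding rel_cohomology_def cohomology_def Z B ..
  have "(\<lambda>A. snd ` A) \<in> linear_isos (quotient_space ({0 :: 'b form} \<times> ?Z) ({0 :: 'b form} \<times> ?B))
      (quotient_space (snd ` ({0 :: 'b form} \<times> ?Z)) (snd ` ({0 :: 'b form} \<times> ?B)))"
    by (rule quotient_space_image_iso[OF linear_snd, where K = "{0} \<times> UNIV"])
      (auto simp: subspace_def zero_prod_def inj_on_def)
  then show "(\<lambda>A. snd ` A) \<in> linear_isos (rel_cohomology M N F k) (reduced_de_rham M (k - 1))"
    by (simp only: coh reduced_de_rham_def snd_image_times) simp
qed

theorem propositionA2:
  fixes M :: "'a manifold" and N :: "'b manifold" and F :: "'a \<Rightarrow> 'b"
  assumes "smooth_manifold M" and "smooth_manifold N" and "smooth_map M N F"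
  shows "(topspace (mtop M) = {} \<longrightarrow>
      (\<forall>k. rel_forms M N k = diff_forms N k \<times> {0} \<and>
           (\<forall>\<alpha>\<in>diff_forms N k. rel_d M N F (\<alpha>, 0) = (ext_deriv N \<alpha>, 0)) \<and>
           rel_chains M N k = smooth_chains N k \<times> {0} \<and>
           (\<forall>S\<in>smooth_chains N k. rel_boundary F k (S, 0) = (chain_boundary k S, 0)) \<and>
           (\<forall>\<alpha>\<in>diff_forms N k. \<forall>S\<in>smooth_chains N k.
              rel_pairing M N k (\<alpha>, 0) (S, 0) = chain_integral N k S \<alpha>) \<and>
           (\<lambda>A. fst ` A) \<in> linear_isos (rel_cohomology M N F k) (de_rham N k) \<and>
           (\<lambda>Z. fst ` Z) \<in> iso (rel_homology M N F k) (smooth_homology N k) \<and>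
           (\<forall>A\<in>carrier (rel_cohomology M N F k). \<forall>Z\<in>carrier (rel_homology M N F k).
              class_pairing (rel_pairing M N k) A Z =
              class_pairing (\<lambda>\<alpha> S. chain_integral N k S \<alpha>) (fst ` A) (fst ` Z)))) \<and>
    ((\<exists>p. topspace (mtop N) = {p}) \<longrightarrow>
      linear (\<lambda>c. (const_form N c, 0 :: 'a form)) \<and>
      bij_betw (\<lambda>c. (const_form N c, 0)) UNIV (rel_forms M N 0) \<and>
      bij_betw (function_form M) (smooth_functions M) (diff_forms M 0) \<and>
      (\<forall>k\<ge>1. rel_forms M N k = {0} \<times> diff_forms M (k - 1)) \<and>
      (\<forall>c. rel_d M N F (const_form N c, 0) = (0, const_form M c)) \<and>
      (\<forall>k\<ge>1. \<forall>\<beta>\<in>diff_forms M (k - 1). rel_d M N F (0, \<beta>) = (0, - ext_deriv M \<beta>)) \<and>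
      (topspace (mtop M) \<noteq> {} \<longrightarrow>
         carrier (rel_cohomology M N F 0) = {\<zero>\<^bsub>rel_cohomology M N F 0\<^esub>}) \<and>
      (\<forall>k\<ge>1. (\<lambda>A. snd ` A) \<in> linear_isos (rel_cohomology M N F k) (reduced_de_rham M (k - 1))) \<and>
      (\<forall>k\<ge>1. \<forall>\<beta>\<in>diff_forms M (k - 1). \<forall>(S, T)\<in>rel_chains M N k.
         rel_pairing M N k (0, \<beta>) (S, T) = - chain_integral M (k - 1) T \<beta>))"
proof (intro conjI impI)
  assume empty: "topspace (mtop M) = {}"
  show "\<forall>k. rel_forms M N k = diff_forms N k \<times> {0} \<and>
           (\<forall>\<alpha>\<in>diff_forms N k. rel_d M N F (\<alpha>, 0) = (ext_deriv N \<alpha>, 0)) \<and>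
           rel_chains M N k = smooth_chains N k \<times> {0} \<and>
           (\<forall>S\<in>smooth_chains N k. rel_boundary F k (S, 0) = (chain_boundary k S, 0)) \<and>
           (\<forall>\<alpha>\<in>diff_forms N k. \<forall>S\<in>smooth_chains N k.
              rel_pairing M N k (\<alpha>, 0) (S, 0) = chain_integral N k S \<alpha>) \<and>
           (\<lambda>A. fst ` A) \<in> linear_isos (rel_cohomology M N F k) (de_rham N k) \<and>
           (\<lambda>Z. fst ` Z) \<in> iso (rel_homology M N F k) (smooth_homology N k) \<and>
           (\<forall>A\<in>carrier (rel_cohomology M N F k). \<forall>Z\<in>carrier (rel_homology M N F k).
              class_pairing (rel_pairing M N k) A Z =
              class_pairing (\<lambda>\<alpha> S. chain_integral N k S \<alpha>) (fst ` A) (fst ` Z))"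
    by (intro allI conjI ballI relative_complex_of_empty_source[OF assms(1) empty]
        target_edge[OF assms(1) empty])
next
  show "linear (\<lambda>c. (const_form N c, 0 :: 'a form))"
    by (rule linearI) (simp_all add: linear_add[OF linear_const_form] linear_scale[OF linear_const_form]
        del: real_scaleR_def)
next
  show "bij_betw (function_form M) (smooth_functions M) (diff_forms M 0)"
    by (rule bij_betw_function_form[OF assms(1)])
next
  assume "\<exists>p. topspace (mtop N) = {p}"
  then obtain p where p: "topspace (mtop N) = {p}"
    by blast
  note rel = relative_complex_of_point_target[OF assms p]
  have "inj (const_form N)"
    using inj_const_form[OF assms(2)] p by simp
  then have "inj (\<lambda>c. (const_form N c, 0 :: 'a form))"
    by (simp add: inj_on_def)
  then show "bij_betw (\<lambda>c. (const_form N c, 0)) UNIV (rel_forms M N 0)"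
    by (simp only: bij_betw_def rel(1) simp_thms)
  show "\<forall>k\<ge>1. rel_forms M N k = {0} \<times> diff_forms M (k - 1)"
    by (intro allI impI rel(2))
  show "\<forall>c. rel_d M N F (const_form N c, 0) = (0, const_form M c)"
    by (intro allI rel(3))
  show "\<forall>k\<ge>1. \<forall>\<beta>\<in>diff_forms M (k - 1). rel_d M N F (0, \<beta>) = (0, - ext_deriv M \<beta>)"
    by (intro allI impI ballI rel(4))
  show "carrier (rel_cohomology M N F 0) = {\<zero>\<^bsub>rel_cohomology M N F 0\<^esub>}"
    if "topspace (mtop M) \<noteq> {}"
    by (rule source_edge(1)[OF assms p that])
  show "\<forall>k\<ge>1. (\<lambda>A. snd ` A) \<in> linear_isos (rel_cohomology M N F k) (reduced_de_rham M (k - 1))"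
    by (intro allI impI source_edge(2)[OF assms p])
next
  show "\<forall>k\<ge>1. \<forall>\<beta>\<in>diff_forms M (k - 1). \<forall>(S, T)\<in>rel_chains M N k.
         rel_pairing M N k (0, \<beta>) (S, T) = - chain_integral M (k - 1) T \<beta>"
    by (simp add: rel_pairing_def chain_integral_zero_form case_prod_beta)
qed

end
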